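(* Let $(\Lambda,\Gamma)=(\{\Lambda_j\}_{j\in J},\{\Gamma_j\}_{j\in J})$ be a bi-$g$-frame for $\mathcal U$ with respect to $\{\mathcal V_j\}_{j\in J}$. Then $\Lambda=\{\Lambda_j\}_{j\in J}$ is a $g$-Riesz basis for $\mathcal U$ with respect to $\{\mathcal V_j\}_{j\in J}$ if and only if $\Gamma=\{\Gamma_j\}_{j\in J}$ is a $g$-Riesz basis for $\mathcal U$ with respect to $\{\mathcal V_j\}_{j\in J}$.
   Context: $\mathcal U$ and $\mathcal V$ are complex Hilbert spaces, $J\subseteq\mathbb Z$, and $\{\mathcal V_j\}_{j\in J}$ is a sequence of closed subspaces of $\mathcal V$. $\mathcal L(\mathcal U,\mathcal V_j)$ is the space of bounded linear operators from $\mathcal U$ into $\mathcal V_j$. A pair $(\Lambda,\Gamma)$ with $\Lambda_j,\Gamma_j\in\mathcal L(\mathcal U,\mathcal V_j)$ is a bi-$g$-frame for $\mathcal U$ with respect to $\{\mathcal V_j\}_{j\in J}$ if there exist constants $C,D>0$ such that for every $f\in\mathcal U$ the series $\sum_{j\in J}\langle\Lambda_j f,\Gamma_j f\rangle_{\mathcal V_j}$ converges (absolutely), has a real value, and $$C\|f\|^2\le\sum_{j\in J}\langle\Lambda_j f,\Gamma_j f\rangle_{\mathcal V_j}\le D\|f\|^2 .$$ A sequence $\{\Lambda_j\in\mathcal L(\mathcal U,\mathcal V_j)\}_{j\in J}$ is a $g$-Riesz basis for $\mathcal U$ with respect to $\{\mathcal V_j\}_{j\in J}$ if (i) it is $g$-complete,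 i.e. $\{f\in\mathcal U:\Lambda_j f=0\text{ for all }j\in J\}=\{0\}$, and (ii) there exist constants $A,B>0$ such that for every finite subset $J_1\subseteq J$ and all $g_j\in\mathcal V_j$ $(j\in J_1)$, $$A\sum_{j\in J_1}\|g_j\|^2\le\Big\|\sum_{j\in J_1}\Lambda_j^*g_j\Big\|^2\le B\sum_{j\in J_1}\|g_j\|^2 .$$ *)

theory Defs
  imports "HOL-Analysis.Analysis"
begin

text \<open>Complex inner product spaces are not part of the distribution. The inner product is linear
  in the first argument. The norm, metric and topology are those of \<^class>\<open>real_normed_vector\<close>
  and are tied to the inner product by the last axiom.\<close>

class complex_inner = real_normed_vector +
  fixes scaleC :: "complex \<Rightarrow> 'a \<Rightarrow> 'a"
    and cinner :: "'a \<Rightarrow> 'a \<Rightarrow> complex"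
  assumes scaleC_add_right: "scaleC c (x + y) = scaleC c x + scaleC c y"
    and scaleC_add_left: "scaleC (c + d) x = scaleC c x + scaleC d x"
    and scaleC_scaleC: "scaleC c (scaleC d x) = scaleC (c * d) x"
    and scaleC_one: "scaleC 1 x = x"
    and scaleR_scaleC: "scaleR r x = scaleC (complex_of_real r) x"
    and cinner_commute: "cinner x y = cnj (cinner y x)"
    and cinner_add_left: "cinner (x + y) z = cinner x z + cinner y z"
    and cinner_scaleC_left: "cinner (scaleC c x) y = c * cinner x y"
    and cinner_ge_zero: "0 \<le> Re (cinner x x)"
    and cinner_eq_zero_iff: "cinner x x = 0 \<longleftrightarrow> x = 0"
    and norm_eq_sqrt_cinner: "norm x = sqrt (Re (cinner x x))"

class complex_hilbert_space = complex_inner + complete_space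

instantiation complex :: complex_hilbert_space
begin

definition scaleC_complex :: "complex \<Rightarrow> complex \<Rightarrow> complex"
  where "scaleC_complex c x = c * x"

definition cinner_complex :: "complex \<Rightarrow> complex \<Rightarrow> complex"
  where "cinner_complex x y = x * cnj y"

instance
  by standard
    (auto simp: scaleC_complex_def cinner_complex_def algebra_simps scaleR_conv_of_real cmod_def
      power2_eq_square)

end

definition closed_csubspace :: "'v::complex_inner set \<Rightarrow> bool"
  where "closed_csubspace W \<longleftrightarrow>
    subspace W \<and> (\<forall>c. \<forall>x\<in>W. scaleC c x \<in> W) \<and> closed W"

definition bounded_clinear :: "('u::complex_inner \<Rightarrow> 'v::complex_inner) \<Rightarrow> bool"
  where "bounded_clinear T \<longleftrightarrow>
    bounded_linear T \<and> (\<forall>c x. T (scaleC c x) = scaleC c (T x))"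

definition bounded_ops :: "'v::complex_inner set \<Rightarrow> ('u::complex_inner \<Rightarrow> 'v) set"
  where "bounded_ops W = {T. bounded_clinear T \<and> range T \<subseteq> W}"

text \<open>The vector characterised below exists and is unique for bounded \<open>T\<close> on a Hilbert space
  (Riesz representation). If \<open>T\<close> maps into a closed subspace \<open>W\<close>, the adjoint of \<open>T\<close> regarded as an
  operator into \<open>W\<close> is the restriction of \<open>cadjoint T\<close> to \<open>W\<close>.\<close>

definition cadjoint :: "('u::complex_inner \<Rightarrow> 'v::complex_inner) \<Rightarrow> 'v \<Rightarrow> 'u"
  where "cadjoint T g = (THE u. \<forall>f. cinner (T f) g = cinner f u)"

definition bi_g_frame ::
    "int set \<Rightarrow> (int \<Rightarrow> 'v::complex_hilbert_space set) \<Rightarrow>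
     (int \<Rightarrow> 'u::complex_hilbert_space \<Rightarrow> 'v) \<Rightarrow> (int \<Rightarrow> 'u \<Rightarrow> 'v) \<Rightarrow> bool"
  where "bi_g_frame J V \<Lambda> \<Gamma> \<longleftrightarrow>
    (\<forall>j\<in>J. \<Lambda> j \<in> bounded_ops (V j) \<and> \<Gamma> j \<in> bounded_ops (V j)) \<and>
    (\<exists>C>0. \<exists>D>0. \<forall>f.
       (\<lambda>j. cmod (cinner (\<Lambda> j f) (\<Gamma> j f))) summable_on J \<and>
       (\<Sum>\<^sub>\<infinity>j\<in>J. cinner (\<Lambda> j f) (\<Gamma> j f)) \<in> \<real> \<and>
       C * (norm f)\<^sup>2 \<le> Re (\<Sum>\<^sub>\<infinity>j\<in>J. cinner (\<Lambda> j f) (\<Gamma> j f)) \<and>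
       Re (\<Sum>\<^sub>\<infinity>j\<in>J. cinner (\<Lambda> j f) (\<Gamma> j f)) \<le> D * (norm f)\<^sup>2)"

definition g_complete :: "int set \<Rightarrow> (int \<Rightarrow> 'u::complex_inner \<Rightarrow> 'v::complex_inner) \<Rightarrow> bool"
  where "g_complete J \<Lambda> \<longleftrightarrow> {f. \<forall>j\<in>J. \<Lambda> j f = 0} = {0}"

definition g_Riesz_basis ::
    "int set \<Rightarrow> (int \<Rightarrow> 'v::complex_hilbert_space set) \<Rightarrow>
     (int \<Rightarrow> 'u::complex_hilbert_space \<Rightarrow> 'v) \<Rightarrow> bool"
  where "g_Riesz_basis J V \<Lambda> \<longleftrightarrow>
    (\<forall>j\<in>J. \<Lambda> j \<in> bounded_ops (V j)) \<and>
    g_complete J \<Lambda> \<and>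
    (\<exists>A>0. \<exists>B>0. \<forall>J\<^sub>1 g. finite J\<^sub>1 \<and> J\<^sub>1 \<subseteq> J \<and> (\<forall>j\<in>J\<^sub>1. g j \<in> V j) \<longrightarrow>
       A * (\<Sum>j\<in>J\<^sub>1. (norm (g j))\<^sup>2) \<le> (norm (\<Sum>j\<in>J\<^sub>1. cadjoint (\<Lambda> j) (g j)))\<^sup>2 \<and>
       (norm (\<Sum>j\<in>J\<^sub>1. cadjoint (\<Lambda> j) (g j)))\<^sup>2 \<le> B * (\<Sum>j\<in>J\<^sub>1. (norm (g j))\<^sup>2))"

end

(* Let Lambda be a g-Riesz basis with bounds A, B. Given finitely many g_j in V_j, Riesz representation
   yields f with Lambda_j f = g_j (and 0 at the other indices), and |f|^2 is comparable to
   sum |g_j|^2. For u = sum Gamma_j^* g_j this gives <u, v> = sum <Lambda_j f, Gamma_j v>, a finite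
   sum. With v = f the lower frame bound yields C |f| <= |u|. With v = u the upper frame bound,
   through polarization of the form q(f) = sum <Lambda_j f, Gamma_j f>, yields |u| <= 2 D |f|.
   So no Bessel bound for Gamma is needed in advance. *)
theory Submission
  imports Defs
begin

section \<open>Complex inner product spaces: algebra, norm and Cauchy-Schwarz\<close>

lemma cinner_add_right: "cinner x (y + z) = cinner x y + cinner x (z::'a::complex_inner)"
  by (metis cinner_add_left cinner_commute complex_cnj_add)

lemma cinner_scaleC_right: "cinner x (scaleC c y) = cnj c * cinner x (y::'a::complex_inner)"
  by (metis cinner_commute cinner_scaleC_left complex_cnj_mult)

lemma scaleC_zero_left: "scaleC 0 x = (0::'a::complex_inner)"
  by (metis of_real_0 scaleR_scaleC scaleR_zero_left)

lemma scaleC_minus_one: "scaleC (- 1) x = - (x::'a::complex_inner)"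
  by (metis of_real_1 of_real_minus scaleR_minus1_left scaleR_scaleC)

lemma cinner_minus_left: "cinner (- x) y = - cinner x (y::'a::complex_inner)"
  by (metis cinner_scaleC_left mult_minus1 scaleC_minus_one)

lemma cinner_minus_right: "cinner x (- y) = - cinner x (y::'a::complex_inner)"
  by (metis cinner_commute cinner_minus_left complex_cnj_minus)

lemma cinner_diff_left: "cinner (x - y) z = cinner x z - cinner y (z::'a::complex_inner)"
  by (metis cinner_add_left cinner_minus_left diff_conv_add_uminus)

lemma cinner_diff_right: "cinner x (y - z) = cinner x y - cinner x (z::'a::complex_inner)"
  by (metis cinner_add_right cinner_minus_right diff_conv_add_uminus)

lemma cinner_zero_left [simp]: "cinner 0 (x::'a::complex_inner) = 0"
  by (metis cinner_diff_left diff_self)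

lemma cinner_zero_right [simp]: "cinner (x::'a::complex_inner) 0 = 0"
  by (metis cinner_diff_right diff_self)

lemma cinner_sum_left:
  "cinner (\<Sum>i\<in>F. f i) (y::'a::complex_inner) = (\<Sum>i\<in>F. cinner (f i) y)"
  by (induction F rule: infinite_finite_induct) (auto simp: cinner_add_left)

lemma cinner_self: "cinner x x = of_real ((norm (x::'a::complex_inner))\<^sup>2)"
proof -
  have "Im (cinner x x) = 0"
    by (metis cinner_commute complex_cnj cnj.sel(2) equal_neg_zero)
  then show ?thesis
    by (simp add: norm_eq_sqrt_cinner cinner_ge_zero complex_eq_iff)
qed

lemma norm_scaleC: "norm (scaleC c x) = cmod c * norm (x::'a::complex_inner)"
proof -
  have "complex_of_real ((norm (scaleC c x))\<^sup>2) = c * cnj c * of_real ((norm x)\<^sup>2)"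
    unfolding cinner_self[symmetric] by (simp add: cinner_scaleC_left cinner_scaleC_right)
  also have "\<dots> = of_real ((cmod c * norm x)\<^sup>2)"
    by (simp only: complex_norm_square[symmetric] of_real_mult power_mult_distrib)
  finally have "(norm (scaleC c x))\<^sup>2 = (cmod c * norm x)\<^sup>2"
    by (simp only: of_real_eq_iff)
  then show ?thesis by (rule power2_eq_imp_eq) auto
qed

text \<open>The quadratic in \<open>t\<close> behind the parallelogram law, the orthogonality of
  minimal vectors and Cauchy-Schwarz.\<close>

lemma norm_add_scaleC_square:
  "(norm (x + scaleC t y))\<^sup>2 =
    (norm x)\<^sup>2 + 2 * Re (t * cinner y x) + (cmod t)\<^sup>2 * (norm (y::'a::complex_inner))\<^sup>2"
proof -
  have "(norm (x + scaleC t y))\<^sup>2 = Re (cinner (x + scaleC t y) (x + scaleC t y))"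
    by (simp only: cinner_self Re_complex_of_real)
  also have "\<dots> = Re (cinner x x) + Re (t * cinner y x) + Re (cinner x (scaleC t y))
      + Re (cinner (scaleC t y) (scaleC t y))"
    by (simp add: cinner_add_left cinner_add_right cinner_scaleC_left)
  also have "Re (cinner x (scaleC t y)) = Re (t * cinner y x)"
    by (metis cinner_commute cinner_scaleC_left cnj.sel(1))
  finally show ?thesis
    by (simp only: cinner_self Re_complex_of_real norm_scaleC power_mult_distrib)
qed

lemma parallelogram_law:
  "(norm (x - y))\<^sup>2 + (norm (x + y))\<^sup>2 = 2 * (norm x)\<^sup>2 + 2 * (norm (y::'a::complex_inner))\<^sup>2"
  using norm_add_scaleC_square[of x 1 y] norm_add_scaleC_square[of x "-1" y]
  by (simp add: scaleC_one scaleC_minus_one)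

text \<open>Moving \<open>x\<close> along \<open>y\<close> by a small negative multiple of the
  conjugate of \<open>cinner y x\<close> lowers the norm to first order, unless that inner product
  vanishes.\<close>

lemma cinner_eq_zero_if_minimal:
  fixes x y :: "'a::complex_inner"
  assumes "\<And>t. (norm x)\<^sup>2 \<le> (norm (x + scaleC t y))\<^sup>2"
  shows "cinner y x = 0"
proof -
  define a where "a = cinner y x"
  \<comment> \<open>The optimal step length would be 1 / |y|^2. The added 1 covers
    \<open>y = 0\<close> and still keeps the second-order term at most half of the first-order
    gain.\<close>
  define s where "s = 1 / (1 + (norm y)\<^sup>2)"
  have pos: "1 + (norm y)\<^sup>2 > 0"
    by (smt (verit) zero_le_power2)
  have s: "s > 0" "s * (norm y)\<^sup>2 \<le> 1"
    using pos by (auto simp: s_def field_simps)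
  have "cnj a * a = of_real ((cmod a)\<^sup>2)"
    by (metis complex_norm_square mult.commute)
  then have "Re (- of_real s * cnj a * a) = - s * (cmod a)\<^sup>2"
    by (simp add: mult.assoc del: of_real_power)
  moreover have "(cmod (- of_real s * cnj a))\<^sup>2 = s\<^sup>2 * (cmod a)\<^sup>2"
    by (simp add: norm_mult power_mult_distrib)
  ultimately have "0 \<le> - 2 * s * (cmod a)\<^sup>2 + s\<^sup>2 * (cmod a)\<^sup>2 * (norm y)\<^sup>2"
    using assms[of "- of_real s * cnj a"]
    unfolding norm_add_scaleC_square a_def[symmetric] by simp
  also have "\<dots> = s * (cmod a)\<^sup>2 * (s * (norm y)\<^sup>2 - 2)"
    by (simp add: algebra_simps power2_eq_square)
  also have "\<dots> \<le> s * (cmod a)\<^sup>2 * (- 1)"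
    using s by (intro mult_left_mono) auto
  finally have "s * (cmod a)\<^sup>2 \<le> 0" by simp
  then have "(cmod a)\<^sup>2 \<le> 0"
    using s(1) by (simp add: mult_le_0_iff)
  then show ?thesis by (simp add: a_def)
qed

lemma Cauchy_Schwarz_cinner: "cmod (cinner x y) \<le> norm x * norm (y::'a::complex_inner)"
proof (cases "y = 0")
  case False
  define a where "a = cinner y x"
  define n where "n = (norm y)\<^sup>2"
  have n: "n > 0" using False by (simp add: n_def)
  \<comment> \<open>This \<open>t\<close> minimizes |x + t y|^2, and nonnegativity of the minimum is
    the squared claim.\<close>
  define t where "t = - of_real (1/n) * cnj a"
  have "cnj a * a = of_real ((cmod a)\<^sup>2)"
    by (metis complex_norm_square mult.commute)
  then have "t * a = of_real (- (1/n) * (cmod a)\<^sup>2)"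
    by (simp add: t_def mult.assoc)
  then have "Re (t * a) = - (1/n) * (cmod a)\<^sup>2"
    by (simp only: Re_complex_of_real)
  moreover have "(cmod t)\<^sup>2 = (1/n)\<^sup>2 * (cmod a)\<^sup>2"
    using n by (simp add: t_def norm_mult power_mult_distrib norm_divide power_divide)
  moreover have "0 \<le> (norm x)\<^sup>2 + 2 * Re (t * a) + (cmod t)\<^sup>2 * n"
    using zero_le_power2[of "norm (x + scaleC t y)"]
    unfolding norm_add_scaleC_square a_def n_def .
  ultimately have "0 \<le> (norm x)\<^sup>2 - 2 * ((1/n) * (cmod a)\<^sup>2) + (1/n)\<^sup>2 * (cmod a)\<^sup>2 * n"
    by simp
  also have "\<dots> = (norm x)\<^sup>2 - (cmod a)\<^sup>2 / n"
    using n by (simp add: field_simps power2_eq_square)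
  finally have "(cmod a)\<^sup>2 \<le> (norm x * norm y)\<^sup>2"
    using n by (simp add: field_simps n_def power_mult_distrib)
  then have "cmod a \<le> norm x * norm y"
    by (rule power2_le_imp_le) simp
  then show ?thesis
    by (metis a_def cinner_commute complex_mod_cnj)
qed simp

lemma tendsto_cinner_left:
  fixes z :: "'a::complex_inner"
  assumes "(w \<longlongrightarrow> x) F"
  shows "((\<lambda>n. cinner (w n) z) \<longlongrightarrow> cinner x z) F"
proof -
  have "((\<lambda>n. norm (w n - x) * norm z) \<longlongrightarrow> 0) F"
    using tendsto_mult_left_zero[OF tendsto_norm_zero[OF LIM_zero[OF assms]]] .
  then have "((\<lambda>n. cinner (w n) z - cinner x z) \<longlongrightarrow> 0) F"
    by (rule Lim_null_comparison[rotated])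
      (auto simp: cinner_diff_left[symmetric] intro!: always_eventually Cauchy_Schwarz_cinner)
  then show ?thesis by (rule LIM_zero_cancel)
qed

section \<open>Riesz representation for a bounded linear relation\<close>

text \<open>The functional is given by its graph, a linear relation. It need not be defined on a closed
  subspace, and its well-definedness is a consequence of the bound.\<close>

lemma Riesz_representation_relation:
  fixes G :: "('a::complex_hilbert_space \<times> complex) set"
  assumes add: "\<And>w c w' c'. (w, c) \<in> G \<Longrightarrow> (w', c') \<in> G \<Longrightarrow> (w + w', c + c') \<in> G"
    and scale: "\<And>w c t. (w, c) \<in> G \<Longrightarrow> (scaleC t w, t * c) \<in> G"
    and bound: "\<And>w c. (w, c) \<in> G \<Longrightarrow> cmod c \<le> M * norm w"
    and M: "M \<ge> 0"
  shows "\<exists>f. (\<forall>w c. (w, c) \<in> G \<longrightarrow> cinner w f = c) \<and> norm f \<le> M"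
proof (cases "\<forall>(w, c)\<in>G. c = 0")
  case True
  then show ?thesis using M by (intro exI[of _ 0]) auto
next
  case False
  then obtain w0 c0 where "(w0, c0) \<in> G" "c0 \<noteq> 0" by auto
  from scale[OF this(1), of "1 / c0"] this(2) have w1: "(scaleC (1 / c0) w0, 1) \<in> G" by simp
  \<comment> \<open>A representing vector is a multiple of the shortest vector in the closure of
    this level set, since that vector is orthogonal to all \<open>y\<close> with
    \<open>(y, 0) \<in> G\<close>. By the rescaled pair above, \<open>K\<close> is nonempty.\<close>
  define K where "K = {w. (w, 1) \<in> G}"
  define d where "d = Inf ((\<lambda>w. (norm w)\<^sup>2) ` K)"
  have ne: "(\<lambda>w. (norm w)\<^sup>2) ` K \<noteq> {}" using w1 by (auto simp: K_def)
  have "M \<noteq> 0" using bound[OF w1] by auto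
  then have Mpos: "M > 0" using M by simp
  have "1 / M\<^sup>2 \<le> (norm w)\<^sup>2" if "w \<in> K" for w
  proof -
    have "1 \<le> M * norm w" using bound[of w 1] that by (simp add: K_def)
    then have "1\<^sup>2 \<le> (M * norm w)\<^sup>2" by (intro power_mono) auto
    then show ?thesis using Mpos by (simp add: field_simps)
  qed
  \<comment> \<open>Used twice: it makes \<open>d\<close> positive, so that division by
    \<open>d\<close> is possible, and it gives \<open>norm f \<le> M\<close> at the end, where |f|^2
    = 1 / d.\<close>
  then have dM: "1 / M\<^sup>2 \<le> d"
    unfolding d_def using ne by (intro cInf_greatest) auto
  then have dpos: "d > 0" using Mpos by (smt (verit) zero_less_divide_1_iff zero_less_power)
  have dle: "d \<le> (norm w)\<^sup>2" if "w \<in> K" for w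
    unfolding d_def using that by (intro cInf_lower bdd_belowI[of _ 0]) auto
  have "\<exists>w\<in>K. (norm w)\<^sup>2 < d + inverse (real (Suc n))" for n
  proof -
    have "Inf ((\<lambda>w. (norm w)\<^sup>2) ` K) < d + inverse (real (Suc n))"
      by (simp add: d_def)
    from cInf_lessD[OF ne this] show ?thesis by auto
  qed
  then obtain w where w: "\<And>n. w n \<in> K" "\<And>n. (norm (w n))\<^sup>2 < d + inverse (real (Suc n))"
    by metis
  have lim_d: "(\<lambda>n. (norm (w n))\<^sup>2) \<longlonglongrightarrow> d"
  proof (rule tendsto_sandwich[of "\<lambda>_. d" _ _ "\<lambda>n. d + inverse (real (Suc n))"])
    show "(\<lambda>n. d + inverse (real (Suc n))) \<longlonglongrightarrow> d"
      using tendsto_add[OF tendsto_const LIMSEQ_inverse_real_of_nat, of d] by simp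
    show "(\<lambda>n. d) \<longlonglongrightarrow> d" by simp
    show "\<forall>\<^sub>F n in sequentially. d \<le> (norm (w n))\<^sup>2"
      by (intro always_eventually allI dle w)
    show "\<forall>\<^sub>F n in sequentially. (norm (w n))\<^sup>2 \<le> d + inverse (real (Suc n))"
      by (intro always_eventually allI less_imp_le w)
  qed
  \<comment> \<open>The midpoint of two points of \<open>K\<close> is again in \<open>K\<close>, so
    its squared norm is at least \<open>d\<close>; the parallelogram law does the rest.\<close>
  have diff: "(norm (x - y))\<^sup>2 \<le> 2 * (norm x)\<^sup>2 + 2 * (norm y)\<^sup>2 - 4 * d"
    if "x \<in> K" "y \<in> K" for x y
  proof -
    have "(scaleC (1/2) (x + y), 1) \<in> G"
      using scale[OF add[of x 1 y 1], of "1/2"] that by (simp add: K_def)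
    then have "d \<le> (norm (scaleC (1/2) (x + y)))\<^sup>2" by (intro dle) (simp add: K_def)
    then have "4 * d \<le> (norm (x + y))\<^sup>2"
      by (simp add: norm_scaleC power_mult_distrib power2_eq_square norm_divide)
    then show ?thesis using parallelogram_law[of x y] by linarith
  qed
  have "Cauchy w"
  proof (rule metric_CauchyI)
    fix e :: real assume e: "e > 0"
    \<comment> \<open>With tolerance e^2 / 4 for both terms, \<open>diff\<close> yields exactly
      e^2.\<close>
    then have "\<forall>\<^sub>F n in sequentially. (norm (w n))\<^sup>2 < d + e\<^sup>2 / 4"
      using order_tendstoD(2)[OF lim_d] by simp
    then obtain N where N: "\<And>n. n \<ge> N \<Longrightarrow> (norm (w n))\<^sup>2 < d + e\<^sup>2 / 4"
      by (auto simp: eventually_sequentially)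
    have "dist (w m) (w n) < e" if "m \<ge> N" "n \<ge> N" for m n
    proof -
      have "(norm (w m - w n))\<^sup>2 < e\<^sup>2"
        using diff[OF w(1) w(1), of m n] N[OF that(1)] N[OF that(2)] by linarith
      then show ?thesis using e by (simp add: dist_norm power2_less_imp_less)
    qed
    then show "\<exists>N. \<forall>m\<ge>N. \<forall>n\<ge>N. dist (w m) (w n) < e" by blast
  qed
  then obtain x where x: "w \<longlonglongrightarrow> x" by (auto simp: Cauchy_convergent_iff convergent_def)
  have nx: "(norm x)\<^sup>2 = d"
    using LIMSEQ_unique[OF tendsto_power[OF tendsto_norm[OF x]] lim_d] .
  \<comment> \<open>The limit \<open>x\<close> may lie outside \<open>K\<close>, so its minimality
    is tested on \<open>w n + scaleC t y\<close>, which stays in \<open>K\<close>, and then passed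
    to the limit.\<close>
  have ortho: "cinner y x = 0" if y: "(y, 0) \<in> G" for y
  proof (rule cinner_eq_zero_if_minimal)
    fix t
    have "d \<le> (norm (w n + scaleC t y))\<^sup>2" for n
      using add[OF _ scale[OF y, of t], of "w n" 1] w(1)[of n]
      by (intro dle) (simp add: K_def)
    moreover have "(\<lambda>n. (norm (w n + scaleC t y))\<^sup>2) \<longlonglongrightarrow> (norm (x + scaleC t y))\<^sup>2"
      by (intro tendsto_intros x)
    ultimately show "(norm x)\<^sup>2 \<le> (norm (x + scaleC t y))\<^sup>2"
      unfolding nx by (intro LIMSEQ_le_const) auto
  qed
  \<comment> \<open>Subtracting \<open>c\<close> times \<open>w n\<close> from \<open>y\<close>
    brings the value down to 0, so \<open>ortho\<close> applies; letting \<open>n\<close> grow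
    replaces \<open>cinner (w n) x\<close> by |x|^2 = d.\<close>
  have val: "cinner y x = c * of_real d" if y: "(y, c) \<in> G" for y c
  proof -
    have "cinner y x = c * cinner (w n) x" for n
    proof -
      have "(y + scaleC (- c) (w n), c + (- c) * 1) \<in> G"
        using w(1)[of n] by (intro add y scale) (simp add: K_def)
      then have "cinner (y + scaleC (- c) (w n)) x = 0" by (intro ortho) simp
      then show ?thesis by (simp add: cinner_add_left cinner_scaleC_left)
    qed
    moreover have "(\<lambda>n. c * cinner (w n) x) \<longlonglongrightarrow> c * cinner x x"
      by (intro tendsto_intros tendsto_cinner_left x)
    ultimately show ?thesis
      by (simp add: LIMSEQ_const_iff cinner_self nx del: of_real_power)
  qed
  define f where "f = scaleC (of_real (1 / d)) x"
  have "cinner y f = c" if "(y, c) \<in> G" for y c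
    using val[OF that] dpos by (simp add: f_def cinner_scaleC_right)
  moreover have "norm f \<le> M"
  proof (rule power2_le_imp_le)
    have "(norm f)\<^sup>2 = 1 / d"
      using dpos nx by (simp add: f_def norm_scaleC power_mult_distrib power2_eq_square norm_divide)
    also have "\<dots> \<le> M\<^sup>2" using dM dpos Mpos by (simp add: field_simps)
    finally show "(norm f)\<^sup>2 \<le> M\<^sup>2" .
  qed (rule M)
  ultimately show ?thesis by blast
qed

section \<open>Bounded operators and their adjoints\<close>

lemma bounded_ops_add: "T \<in> bounded_ops W \<Longrightarrow> T (x + y) = T x + T y"
  by (simp add: bounded_ops_def bounded_clinear_def linear_simps)

lemma bounded_ops_scaleC: "T \<in> bounded_ops W \<Longrightarrow> T (scaleC c x) = scaleC c (T x)"
  by (simp add: bounded_ops_def bounded_clinear_def)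

lemma bounded_ops_range: "T \<in> bounded_ops W \<Longrightarrow> T x \<in> W"
  by (auto simp: bounded_ops_def)

text \<open>Riesz representation of the functional sending \<open>f\<close> to
  \<open>cinner (T f) g\<close> gives existence, and testing the difference of two candidates
  against itself gives uniqueness. Hence the description in \<open>cadjoint\<close> denotes.\<close>

lemma cinner_cadjoint_right:
  fixes T :: "'u::complex_hilbert_space \<Rightarrow> 'v::complex_inner"
  assumes T: "T \<in> bounded_ops W"
  shows "cinner f (cadjoint T g) = cinner (T f) g"
proof -
  have "bounded_linear T" using T by (simp add: bounded_ops_def bounded_clinear_def)
  then obtain K where K: "K \<ge> 0" "\<And>x. norm (T x) \<le> K * norm x"
    using bounded_linear.nonneg_bounded by (metis mult.commute)
  have "\<exists>u. (\<forall>f c. (f, c) \<in> range (\<lambda>f. (f, cinner (T f) g)) \<longrightarrow> cinner f u = c) \<and>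
     norm u \<le> K * norm g"
  proof (rule Riesz_representation_relation)
    fix w c assume "(w, c) \<in> range (\<lambda>f. (f, cinner (T f) g))"
    then have "cmod c \<le> norm (T w) * norm g" by (auto intro: Cauchy_Schwarz_cinner)
    also have "\<dots> \<le> K * norm w * norm g" by (intro mult_right_mono K) simp
    finally show "cmod c \<le> K * norm g * norm w" by (simp add: mult_ac)
  qed (use K in \<open>auto simp: bounded_ops_add[OF T] bounded_ops_scaleC[OF T] cinner_add_left
      cinner_scaleC_left\<close>)
  then obtain u where "\<And>f. cinner f u = cinner (T f) g" by blast
  then have u: "\<forall>f. cinner (T f) g = cinner f u" by simp
  have "v = u" if "\<forall>f. cinner (T f) g = cinner f v" for v
  proof -
    have "cinner (v - u) (v - u) = 0" using u that by (simp add: cinner_diff_right)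
    then show ?thesis by (simp add: cinner_eq_zero_iff)
  qed
  with u have "\<forall>f. cinner (T f) g = cinner f (cadjoint T g)"
    unfolding cadjoint_def by (rule theI)
  then show ?thesis by simp
qed

lemma cinner_cadjoint_left:
  fixes T :: "'u::complex_hilbert_space \<Rightarrow> 'v::complex_inner"
  assumes T: "T \<in> bounded_ops W"
  shows "cinner (cadjoint T g) f = cinner g (T f)"
proof -
  have "cinner (cadjoint T g) f = cnj (cinner f (cadjoint T g))" by (rule cinner_commute)
  also have "\<dots> = cnj (cinner (T f) g)" by (simp only: cinner_cadjoint_right[OF T])
  also have "\<dots> = cinner g (T f)" by (rule cinner_commute[symmetric])
  finally show ?thesis .
qed

lemma cadjoint_add:
  fixes T :: "'u::complex_hilbert_space \<Rightarrow> 'v::complex_inner"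
  assumes T: "T \<in> bounded_ops W"
  shows "cadjoint T (g + h) = cadjoint T g + cadjoint T h"
proof -
  let ?d = "cadjoint T (g + h) - (cadjoint T g + cadjoint T h)"
  have "cinner ?d ?d = 0"
    by (simp add: cinner_diff_right cinner_add_right cinner_cadjoint_right[OF T])
  then show ?thesis by (simp add: cinner_eq_zero_iff)
qed

lemma cadjoint_scaleC:
  fixes T :: "'u::complex_hilbert_space \<Rightarrow> 'v::complex_inner"
  assumes T: "T \<in> bounded_ops W"
  shows "cadjoint T (scaleC c g) = scaleC c (cadjoint T g)"
proof -
  let ?d = "cadjoint T (scaleC c g) - scaleC c (cadjoint T g)"
  have "cinner ?d ?d = 0"
    by (simp add: cinner_diff_right cinner_scaleC_right cinner_cadjoint_right[OF T])
  then show ?thesis by (simp add: cinner_eq_zero_iff)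
qed

lemma cadjoint_zero:
  fixes T :: "'u::complex_hilbert_space \<Rightarrow> 'v::complex_inner"
  assumes T: "T \<in> bounded_ops W"
  shows "cadjoint T 0 = 0"
  using cadjoint_scaleC[OF T, of 0 0] by (simp add: scaleC_zero_left)

section \<open>Interpolation of finite families under a lower Riesz bound\<close>

lemma norm_sum_cinner_le:
  fixes g h :: "'i \<Rightarrow> 'a::complex_inner"
  shows "cmod (\<Sum>j\<in>F. cinner (h j) (g j)) \<le>
    L2_set (\<lambda>j. norm (h j)) F * L2_set (\<lambda>j. norm (g j)) F"
proof -
  have "cmod (\<Sum>j\<in>F. cinner (h j) (g j)) \<le> (\<Sum>j\<in>F. \<bar>norm (h j)\<bar> * \<bar>norm (g j)\<bar>)"
    by (auto intro!: sum_norm_le Cauchy_Schwarz_cinner)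
  also have "\<dots> \<le> L2_set (\<lambda>j. norm (h j)) F * L2_set (\<lambda>j. norm (g j)) F"
    by (rule L2_set_mult_ineq)
  finally show ?thesis .
qed

text \<open>A solution \<open>f\<close> must satisfy <w, f> = sum <h_j, g_j> for every w = sum
  \<Lambda>_j^* h_j. The lower bound makes this prescription a bounded functional of w, and its
  Riesz vector is the solution.\<close>

lemma g_Riesz_interpolation:
  fixes \<Lambda> :: "int \<Rightarrow> 'u::complex_hilbert_space \<Rightarrow> 'v::complex_hilbert_space"
  assumes V: "\<And>j. j \<in> J \<Longrightarrow> closed_csubspace (V j)"
    and ops: "\<And>j. j \<in> J \<Longrightarrow> \<Lambda> j \<in> bounded_ops (V j)"
    and A: "A > 0"
    and low: "\<And>F h. finite F \<Longrightarrow> F \<subseteq> J \<Longrightarrow> (\<And>j. j \<in> F \<Longrightarrow> h j \<in> V j) \<Longrightarrow>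
      A * (\<Sum>j\<in>F. (norm (h j))\<^sup>2) \<le> (norm (\<Sum>j\<in>F. cadjoint (\<Lambda> j) (h j)))\<^sup>2"
    and F: "finite F" "F \<subseteq> J"
    and g: "\<And>j. j \<in> F \<Longrightarrow> g j \<in> V j"
  shows "\<exists>f. (\<forall>j\<in>J. \<Lambda> j f = (if j \<in> F then g j else 0)) \<and>
    A * (norm f)\<^sup>2 \<le> (\<Sum>j\<in>F. (norm (g j))\<^sup>2)"
proof -
  \<comment> \<open>The target is extended by 0 outside \<open>F\<close>, which turns the required
    vanishing of the other \<Lambda>_j f into part of the same interpolation problem.\<close>
  define k where "k j = (if j \<in> F then g j else 0)" for j
  \<comment> \<open>Finitely supported families, zero outside \<open>E\<close>: sums over
    \<open>E\<close> can then be taken over any larger finite subset of \<open>J\<close>, which is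
    how two families are added.\<close>
  define S where "S = {(E, h). finite E \<and> E \<subseteq> J \<and> (\<forall>j\<in>J. h j \<in> V j) \<and> (\<forall>j. j \<notin> E \<longrightarrow> h j = 0)}"
  define G where "G = (\<lambda>(E, h). (\<Sum>j\<in>E. cadjoint (\<Lambda> j) (h j), \<Sum>j\<in>E. cinner (h j) (k j))) ` S"
  have V0: "0 \<in> V j" if "j \<in> J" for j
    using V[OF that] by (simp add: closed_csubspace_def subspace_0)
  \<comment> \<open>Cauchy-Schwarz bounds the functional by the product of the l2-norms of
    \<open>h\<close> and \<open>k\<close>, and the lower bound gives |h| \<le> |w| / sqrt A.\<close>
  define M where "M = L2_set (\<lambda>j. norm (g j)) F / sqrt A"
  have Lk: "L2_set (\<lambda>j. norm (k j)) E \<le> L2_set (\<lambda>j. norm (g j)) F" if "finite E" for E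
  proof -
    have "(\<Sum>j\<in>E. (norm (k j))\<^sup>2) = (\<Sum>j\<in>E \<inter> F. (norm (g j))\<^sup>2)"
      using that by (intro sum.mono_neutral_cong_right) (auto simp: k_def)
    also have "\<dots> \<le> (\<Sum>j\<in>F. (norm (g j))\<^sup>2)"
      using F by (intro sum_mono2) auto
    finally show ?thesis by (simp add: L2_set_def)
  qed
  have "\<exists>f. (\<forall>w c. (w, c) \<in> G \<longrightarrow> cinner w f = c) \<and> norm f \<le> M"
  proof (rule Riesz_representation_relation)
    fix w c w' c' assume "(w, c) \<in> G" "(w', c') \<in> G"
    then obtain E h E' h' where E: "(E, h) \<in> S" "(E', h') \<in> S"
      and wc: "w = (\<Sum>j\<in>E. cadjoint (\<Lambda> j) (h j))" "c = (\<Sum>j\<in>E. cinner (h j) (k j))"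
      "w' = (\<Sum>j\<in>E'. cadjoint (\<Lambda> j) (h' j))" "c' = (\<Sum>j\<in>E'. cinner (h' j) (k j))"
      by (auto simp: G_def)
    have "w = (\<Sum>j\<in>E \<union> E'. cadjoint (\<Lambda> j) (h j))" "w' = (\<Sum>j\<in>E \<union> E'. cadjoint (\<Lambda> j) (h' j))"
      unfolding wc using E
      by (auto simp: S_def subset_iff intro!: sum.mono_neutral_left cadjoint_zero[OF ops])
    moreover have "c = (\<Sum>j\<in>E \<union> E'. cinner (h j) (k j))" "c' = (\<Sum>j\<in>E \<union> E'. cinner (h' j) (k j))"
      unfolding wc using E by (auto simp: S_def intro!: sum.mono_neutral_left)
    moreover have "(\<Sum>j\<in>E \<union> E'. cadjoint (\<Lambda> j) (h j) + cadjoint (\<Lambda> j) (h' j)) =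
        (\<Sum>j\<in>E \<union> E'. cadjoint (\<Lambda> j) (h j + h' j))"
      using E by (intro sum.cong refl cadjoint_add[OF ops, symmetric]) (auto simp: S_def)
    ultimately have "w + w' = (\<Sum>j\<in>E \<union> E'. cadjoint (\<Lambda> j) (h j + h' j))"
      "c + c' = (\<Sum>j\<in>E \<union> E'. cinner (h j + h' j) (k j))"
      by (simp_all add: sum.distrib cinner_add_left)
    moreover have "(E \<union> E', \<lambda>j. h j + h' j) \<in> S"
      using E V by (auto simp: S_def closed_csubspace_def subspace_add)
    ultimately show "(w + w', c + c') \<in> G"
      by (force simp: G_def)
  next
    fix w c t assume "(w, c) \<in> G"
    then obtain E h where E: "(E, h) \<in> S"
      and wc: "w = (\<Sum>j\<in>E. cadjoint (\<Lambda> j) (h j))" "c = (\<Sum>j\<in>E. cinner (h j) (k j))"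
      by (auto simp: G_def)
    have sc: "scaleC t (\<Sum>j\<in>E. x j) = (\<Sum>j\<in>E. scaleC t (x j))" for x :: "int \<Rightarrow> 'u"
      by (induction E rule: infinite_finite_induct)
        (auto simp: scaleC_add_right, (metis scaleC_scaleC scaleC_zero_left mult_zero_right)+)
    have "scaleC t w = (\<Sum>j\<in>E. cadjoint (\<Lambda> j) (scaleC t (h j)))"
      unfolding wc sc using E
      by (intro sum.cong refl cadjoint_scaleC[OF ops, symmetric]) (auto simp: S_def)
    moreover have "t * c = (\<Sum>j\<in>E. cinner (scaleC t (h j)) (k j))"
      by (simp add: wc sum_distrib_left cinner_scaleC_left)
    moreover have "(E, \<lambda>j. scaleC t (h j)) \<in> S"
    proof -
      have "scaleC t (0::'v) = 0" by (metis scaleC_scaleC scaleC_zero_left mult_zero_right)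
      then show ?thesis using E V by (auto simp: S_def closed_csubspace_def)
    qed
    ultimately show "(scaleC t w, t * c) \<in> G"
      by (force simp: G_def)
  next
    fix w c assume "(w, c) \<in> G"
    then obtain E h where E: "(E, h) \<in> S"
      and wc: "w = (\<Sum>j\<in>E. cadjoint (\<Lambda> j) (h j))" "c = (\<Sum>j\<in>E. cinner (h j) (k j))"
      by (auto simp: G_def)
    have "A * (\<Sum>j\<in>E. (norm (h j))\<^sup>2) \<le> (norm w)\<^sup>2"
      unfolding wc using E by (intro low) (auto simp: S_def)
    then have "sqrt A * L2_set (\<lambda>j. norm (h j)) E \<le> norm w"
      unfolding L2_set_def real_sqrt_mult[symmetric] by (rule real_le_lsqrt[rotated]) simp
    then have hw: "L2_set (\<lambda>j. norm (h j)) E \<le> norm w / sqrt A"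
      using A by (simp add: field_simps)
    have "cmod c \<le> L2_set (\<lambda>j. norm (h j)) E * L2_set (\<lambda>j. norm (k j)) E"
      unfolding wc by (rule norm_sum_cinner_le)
    also have "\<dots> \<le> norm w / sqrt A * L2_set (\<lambda>j. norm (g j)) F"
      using E A by (intro mult_mono hw Lk) (auto simp: S_def)
    finally show "cmod c \<le> M * norm w" by (simp add: M_def mult.commute)
  qed (use A in \<open>simp add: M_def\<close>)
  then obtain f where f: "\<And>w c. (w, c) \<in> G \<Longrightarrow> cinner w f = c" "norm f \<le> M" by blast
  have "\<Lambda> j f = k j" if j: "j \<in> J" for j
  proof -
    \<comment> \<open>The interpolation error lies in \<open>V j\<close>, so it is itself an
      admissible entry. The family with the single entry \<open>x\<close> at \<open>j\<close> shows
      that \<open>x\<close> is orthogonal to itself.\<close>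
    define x where "x = \<Lambda> j f - k j"
    have "k j \<in> V j" using g V0 j by (simp add: k_def)
    then have xV: "x \<in> V j"
      using V[OF j] bounded_ops_range[OF ops[OF j]]
      by (auto simp: x_def closed_csubspace_def subspace_diff)
    have "({j}, \<lambda>i. if i = j then x else 0) \<in> S"
      using xV V0 j by (auto simp: S_def)
    then have "(cadjoint (\<Lambda> j) x, cinner x (k j)) \<in> G"
      unfolding G_def by (force simp: image_iff)
    from f(1)[OF this] have "cinner x x = 0"
      by (simp add: cinner_cadjoint_left[OF ops[OF j]] x_def cinner_diff_right)
    then show ?thesis by (simp add: cinner_eq_zero_iff x_def)
  qed
  moreover have "A * (norm f)\<^sup>2 \<le> (\<Sum>j\<in>F. (norm (g j))\<^sup>2)"
  proof -
    have "(norm f)\<^sup>2 \<le> M\<^sup>2" using f(2) by (intro power_mono) auto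
    also have "M\<^sup>2 = (\<Sum>j\<in>F. (norm (g j))\<^sup>2) / A"
      using A by (simp add: M_def L2_set_def power_divide sum_nonneg)
    finally show ?thesis using A by (simp add: field_simps)
  qed
  ultimately show ?thesis unfolding k_def by blast
qed

section \<open>Bi-g-frames: symmetry, completeness and the bound from the quadratic form\<close>

lemma has_sum_diff:
  fixes f g :: "'i \<Rightarrow> 'a::real_normed_vector"
  assumes "(f has_sum a) I" "(g has_sum b) I"
  shows "((\<lambda>i. f i - g i) has_sum (a - b)) I"
proof -
  have "((\<lambda>i. - g i) has_sum - b) I"
    unfolding has_sum_uminus using assms(2) by simp
  from has_sum_add[OF assms(1) this] show ?thesis by simp
qed

text \<open>Swapping the two sequences conjugates every term, and the total is real, so the sums and
  the frame bounds are unchanged.\<close>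

lemma bi_g_frame_sym:
  assumes "bi_g_frame J V \<Lambda> \<Gamma>"
  shows "bi_g_frame J V \<Gamma> \<Lambda>"
proof -
  have flip: "cinner (\<Gamma> j f) (\<Lambda> j f) = cnj (cinner (\<Lambda> j f) (\<Gamma> j f))" for j f
    by (rule cinner_commute)
  have norm_eq: "cmod (cinner (\<Gamma> j f) (\<Lambda> j f)) = cmod (cinner (\<Lambda> j f) (\<Gamma> j f))" for j f
    unfolding flip by (rule complex_mod_cnj)
  have "(\<Sum>\<^sub>\<infinity>j\<in>J. cinner (\<Lambda> j f) (\<Gamma> j f)) \<in> \<real>" for f
    using assms unfolding bi_g_frame_def by blast
  then have sum_eq: "(\<Sum>\<^sub>\<infinity>j\<in>J. cinner (\<Gamma> j f) (\<Lambda> j f)) =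
      (\<Sum>\<^sub>\<infinity>j\<in>J. cinner (\<Lambda> j f) (\<Gamma> j f))" for f
    unfolding flip infsum_cnj by (simp only: Reals_cnj_iff)
  show ?thesis
    unfolding bi_g_frame_def norm_eq sum_eq
    using assms[unfolded bi_g_frame_def] by blast
qed

text \<open>If all \<Gamma>_j f vanish, so does the form at \<open>f\<close>, and the lower frame
  bound forces \<open>f = 0\<close>.\<close>

lemma bi_g_frame_g_complete:
  assumes frame: "bi_g_frame J V \<Lambda> \<Gamma>"
  shows "g_complete J \<Gamma>"
proof -
  obtain C where C: "C > 0" "\<And>f. C * (norm f)\<^sup>2 \<le> Re (\<Sum>\<^sub>\<infinity>j\<in>J. cinner (\<Lambda> j f) (\<Gamma> j f))"
    using frame unfolding bi_g_frame_def by blast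
  have ops: "\<And>j. j \<in> J \<Longrightarrow> \<Gamma> j \<in> bounded_ops (V j)"
    using frame by (simp add: bi_g_frame_def)
  have "f = 0" if "\<And>j. j \<in> J \<Longrightarrow> \<Gamma> j f = 0" for f
  proof -
    have "(\<Sum>\<^sub>\<infinity>j\<in>J. cinner (\<Lambda> j f) (\<Gamma> j f)) = 0"
      using that by (intro infsum_0) simp
    then have "C * (norm f)\<^sup>2 \<le> 0" using C(2)[of f] by simp
    then show ?thesis using C(1) by (simp add: mult_le_0_iff)
  qed
  moreover have "\<Gamma> j 0 = 0" if "j \<in> J" for j
    by (metis ops[OF that] bounded_ops_scaleC scaleC_zero_left)
  ultimately show ?thesis by (auto simp: g_complete_def)
qed

text \<open>Only the values of the form at \<open>f + u\<close>, \<open>f + \<i> u\<close> and \<open>f + u / (2 D)\<close> enter. Its realness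
  identifies the mixed sum \<open>\<Sum>j. \<langle>\<Lambda>\<^sub>j u, \<Gamma>\<^sub>j f\<rangle>\<close> up to an imaginary part.\<close>

lemma bi_g_frame_form_bound:
  fixes \<Lambda> \<Gamma> :: "int \<Rightarrow> 'u::complex_hilbert_space \<Rightarrow> 'v::complex_hilbert_space"
  assumes ops: "\<And>j. j \<in> J \<Longrightarrow> \<Lambda> j \<in> bounded_ops (V j)" "\<And>j. j \<in> J \<Longrightarrow> \<Gamma> j \<in> bounded_ops (V j)"
    and sm: "\<And>f. (\<lambda>j. cinner (\<Lambda> j f) (\<Gamma> j f)) summable_on J"
    and real: "\<And>f. (\<Sum>\<^sub>\<infinity>j\<in>J. cinner (\<Lambda> j f) (\<Gamma> j f)) \<in> \<real>"
    and nonneg: "\<And>f. 0 \<le> Re (\<Sum>\<^sub>\<infinity>j\<in>J. cinner (\<Lambda> j f) (\<Gamma> j f))"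
    and D: "D > 0" "\<And>f. Re (\<Sum>\<^sub>\<infinity>j\<in>J. cinner (\<Lambda> j f) (\<Gamma> j f)) \<le> D * (norm f)\<^sup>2"
    and fu: "((\<lambda>j. cinner (\<Lambda> j f) (\<Gamma> j u)) has_sum of_real ((norm u)\<^sup>2)) J"
  shows "(norm u)\<^sup>2 \<le> 4 * D\<^sup>2 * (norm f)\<^sup>2"
proof -
  define q where "q x = (\<Sum>\<^sub>\<infinity>j\<in>J. cinner (\<Lambda> j x) (\<Gamma> j x))" for x
  have q: "((\<lambda>j. cinner (\<Lambda> j x) (\<Gamma> j x)) has_sum q x) J" for x
    unfolding q_def using sm by (rule has_sum_infsum)
  define n where "n = (norm u)\<^sup>2"
  have expand: "cinner (\<Lambda> j (f + scaleC t u)) (\<Gamma> j (f + scaleC t u)) =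
      cinner (\<Lambda> j f) (\<Gamma> j f) + t * cnj t * cinner (\<Lambda> j u) (\<Gamma> j u)
      + cnj t * cinner (\<Lambda> j f) (\<Gamma> j u) + t * cinner (\<Lambda> j u) (\<Gamma> j f)" if "j \<in> J" for j t
    using that
    by (simp add: bounded_ops_add[OF ops(1)] bounded_ops_add[OF ops(2)]
        bounded_ops_scaleC[OF ops(1)] bounded_ops_scaleC[OF ops(2)] cinner_add_left
        cinner_add_right cinner_scaleC_left cinner_scaleC_right algebra_simps)
  \<comment> \<open>Convergence of the mixed sum with \<open>u\<close> on the left is not assumed.
    The expansion at \<open>t = 1\<close> writes its terms as a combination of four convergent
    series, and \<open>R\<close> is the resulting value.\<close>
  define R where "R = q (f + scaleC 1 u) - q f - q u - of_real n"
  have "((\<lambda>j. cinner (\<Lambda> j (f + scaleC 1 u)) (\<Gamma> j (f + scaleC 1 u)) - cinner (\<Lambda> j f) (\<Gamma> j f)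
      - cinner (\<Lambda> j u) (\<Gamma> j u) - cinner (\<Lambda> j f) (\<Gamma> j u)) has_sum R) J"
    unfolding R_def n_def by (intro has_sum_diff q fu)
  then have R: "((\<lambda>j. cinner (\<Lambda> j u) (\<Gamma> j f)) has_sum R) J"
    by (rule has_sum_cong[THEN iffD1, rotated]) (simp add: expand)
  have qt: "q (f + scaleC t u) = q f + t * cnj t * q u + cnj t * of_real n + t * R" for t
  proof -
    have "((\<lambda>j. cinner (\<Lambda> j f) (\<Gamma> j f) + t * cnj t * cinner (\<Lambda> j u) (\<Gamma> j u)
      + cnj t * cinner (\<Lambda> j f) (\<Gamma> j u) + t * cinner (\<Lambda> j u) (\<Gamma> j f)) has_sum
      (q f + t * cnj t * q u + cnj t * of_real n + t * R)) J"
      unfolding n_def by (intro has_sum_add has_sum_cmult_right q fu R)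
    then have "((\<lambda>j. cinner (\<Lambda> j (f + scaleC t u)) (\<Gamma> j (f + scaleC t u))) has_sum
      (q f + t * cnj t * q u + cnj t * of_real n + t * R)) J"
      by (rule has_sum_cong[THEN iffD1, rotated]) (simp add: expand)
    then show ?thesis using has_sum_unique[OF q] by blast
  qed
  have Im_q: "Im (q x) = 0" for x
    using real[of x] by (simp add: q_def complex_is_Real_iff)
  \<comment> \<open>At \<open>t = \<i>\<close> the two mixed terms contribute - n + Re R to the
    imaginary part, which is 0 because all values of \<open>q\<close> are real.\<close>
  have ReR: "Re R = n"
    using arg_cong[OF qt[of \<i>], of Im] by (simp add: Im_q)
  \<comment> \<open>The estimates below give (2 t - 2 D t^2) n \<le> 2 D |f|^2. This
    \<open>t\<close> maximizes the left factor, whose value is then 1 / (2 D).\<close>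
  define t where "t = 1 / (2 * D)"
  have t: "t > 0" using D(1) by (simp add: t_def)
  have "Re (q (f + scaleC (of_real t) u)) = Re (q f) + t * t * Re (q u) + 2 * t * n"
    by (simp add: qt ReR Im_q)
  moreover have "Re (q f) \<ge> 0" "t * t * Re (q u) \<ge> 0"
    using nonneg by (simp_all add: q_def)
  ultimately have "2 * t * n \<le> Re (q (f + scaleC (of_real t) u))" by linarith
  also have "\<dots> \<le> D * (norm (f + scaleC (of_real t) u))\<^sup>2"
    unfolding q_def by (rule D(2))
  also have "\<dots> \<le> D * (2 * (norm f)\<^sup>2 + 2 * (t\<^sup>2 * n))"
  proof (intro mult_left_mono)
    have "(norm (scaleC (of_real t) u))\<^sup>2 = t\<^sup>2 * n"
      by (simp add: norm_scaleC power_mult_distrib n_def)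
    then show "(norm (f + scaleC (of_real t) u))\<^sup>2 \<le> 2 * (norm f)\<^sup>2 + 2 * (t\<^sup>2 * n)"
      using parallelogram_law[of f "scaleC (of_real t) u"]
        zero_le_power2[of "norm (f - scaleC (of_real t) u)"] by linarith
  qed (use D in simp)
  finally show ?thesis
    using D(1) by (simp add: t_def n_def field_simps power2_eq_square)
qed

section \<open>Transfer of the Riesz bounds and the equivalence\<close>

lemma bi_g_frame_g_Riesz_basis:
  fixes \<Lambda> \<Gamma> :: "int \<Rightarrow> 'u::complex_hilbert_space \<Rightarrow> 'v::complex_hilbert_space"
  assumes V: "\<And>j. j \<in> J \<Longrightarrow> closed_csubspace (V j)"
    and frame: "bi_g_frame J V \<Lambda> \<Gamma>"
    and Riesz: "g_Riesz_basis J V \<Lambda>"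
  shows "g_Riesz_basis J V \<Gamma>"
proof -
  have ops: "\<And>j. j \<in> J \<Longrightarrow> \<Lambda> j \<in> bounded_ops (V j)" "\<And>j. j \<in> J \<Longrightarrow> \<Gamma> j \<in> bounded_ops (V j)"
    using frame by (auto simp: bi_g_frame_def)
  obtain C D where C: "C > 0" "\<And>f. C * (norm f)\<^sup>2 \<le> Re (\<Sum>\<^sub>\<infinity>j\<in>J. cinner (\<Lambda> j f) (\<Gamma> j f))"
    and D: "D > 0" "\<And>f. Re (\<Sum>\<^sub>\<infinity>j\<in>J. cinner (\<Lambda> j f) (\<Gamma> j f)) \<le> D * (norm f)\<^sup>2"
    and abs: "\<And>f. (\<lambda>j. cmod (cinner (\<Lambda> j f) (\<Gamma> j f))) summable_on J"
    and real: "\<And>f. (\<Sum>\<^sub>\<infinity>j\<in>J. cinner (\<Lambda> j f) (\<Gamma> j f)) \<in> \<real>"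
    using frame unfolding bi_g_frame_def by blast
  have sm: "(\<lambda>j. cinner (\<Lambda> j f) (\<Gamma> j f)) summable_on J" for f
    using abs by (rule abs_summable_summable)
  have nonneg: "0 \<le> Re (\<Sum>\<^sub>\<infinity>j\<in>J. cinner (\<Lambda> j f) (\<Gamma> j f))" for f
    using C(2)[of f] C(1) by (smt (verit) mult_nonneg_nonneg zero_le_power2)
  obtain A B where A: "A > 0" and B: "B > 0"
    and AB: "\<forall>F g. finite F \<and> F \<subseteq> J \<and> (\<forall>j\<in>F. g j \<in> V j) \<longrightarrow>
       A * (\<Sum>j\<in>F. (norm (g j))\<^sup>2) \<le> (norm (\<Sum>j\<in>F. cadjoint (\<Lambda> j) (g j)))\<^sup>2 \<and>
       (norm (\<Sum>j\<in>F. cadjoint (\<Lambda> j) (g j)))\<^sup>2 \<le> B * (\<Sum>j\<in>F. (norm (g j))\<^sup>2)"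
    using Riesz unfolding g_Riesz_basis_def by blast
  \<comment> \<open>With s = sum |g_j|^2, the lower constant combines C |f| \<le> |u| with s \<le> B
    |f|^2, the upper one |u| \<le> 2 D |f| with A |f|^2 \<le> s.\<close>
  have bounds: "C\<^sup>2 / B * (\<Sum>j\<in>F. (norm (g j))\<^sup>2) \<le> (norm (\<Sum>j\<in>F. cadjoint (\<Gamma> j) (g j)))\<^sup>2 \<and>
      (norm (\<Sum>j\<in>F. cadjoint (\<Gamma> j) (g j)))\<^sup>2 \<le> 4 * D\<^sup>2 / A * (\<Sum>j\<in>F. (norm (g j))\<^sup>2)"
    if Fg: "finite F \<and> F \<subseteq> J \<and> (\<forall>j\<in>F. g j \<in> V j)" for F g
  proof -
    define s where "s = (\<Sum>j\<in>F. (norm (g j))\<^sup>2)"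
    define u where "u = (\<Sum>j\<in>F. cadjoint (\<Gamma> j) (g j))"
    have "\<exists>f. (\<forall>j\<in>J. \<Lambda> j f = (if j \<in> F then g j else 0)) \<and> A * (norm f)\<^sup>2 \<le> s"
      unfolding s_def using Fg AB
      by (intro g_Riesz_interpolation[OF V ops(1) A]) auto
    then obtain f where f: "\<And>j. j \<in> J \<Longrightarrow> \<Lambda> j f = (if j \<in> F then g j else 0)"
      and fs: "A * (norm f)\<^sup>2 \<le> s" by blast
    \<comment> \<open>\<Lambda>_j f vanishes outside \<open>F\<close>, so the sum over
      \<open>J\<close> collapses to the finite sum defining \<open>u\<close>.\<close>
    have form: "((\<lambda>j. cinner (\<Lambda> j f) (\<Gamma> j v)) has_sum cinner u v) J" for v
    proof -
      have "cinner u v = (\<Sum>j\<in>F. cinner (\<Lambda> j f) (\<Gamma> j v))"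
        unfolding u_def cinner_sum_left using Fg
        by (intro sum.cong refl) (auto simp: f cinner_cadjoint_left[OF ops(2)] subset_iff)
      then have "((\<lambda>j. cinner (\<Lambda> j f) (\<Gamma> j v)) has_sum cinner u v) F"
        using Fg by (simp add: has_sum_finite)
      then show ?thesis
        by (rule has_sum_cong_neutral[THEN iffD1, rotated -1]) (use Fg in \<open>auto simp: f\<close>)
    qed
    \<comment> \<open>Pairing \<open>f\<close> with w = sum \<Lambda>_j^* g_j returns
      \<open>s\<close>. Cauchy-Schwarz and the upper Riesz bound give s^2 \<le> B s |f|^2, and
      \<open>s\<close> cancels unless it is 0, where the claim is trivial.\<close>
    have "s \<le> B * (norm f)\<^sup>2"
    proof -
      define w where "w = (\<Sum>j\<in>F. cadjoint (\<Lambda> j) (g j))"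
      have "cinner w f = (\<Sum>j\<in>F. cinner (g j) (g j))"
        unfolding w_def cinner_sum_left using Fg
        by (intro sum.cong refl) (auto simp: f cinner_cadjoint_left[OF ops(1)] subset_iff)
      then have "cinner w f = of_real s" by (simp add: s_def cinner_self)
      then have "s \<le> norm w * norm f"
        using Cauchy_Schwarz_cinner[of w f] by simp
      moreover have s0: "0 \<le> s" by (simp add: s_def sum_nonneg)
      ultimately have "s\<^sup>2 \<le> (norm w)\<^sup>2 * (norm f)\<^sup>2"
        by (metis power_mono power_mult_distrib)
      also have "\<dots> \<le> (B * s) * (norm f)\<^sup>2"
        using AB[rule_format, OF Fg] by (intro mult_right_mono) (auto simp: w_def s_def)
      finally have "s * s \<le> s * (B * (norm f)\<^sup>2)"
        by (simp add: power2_eq_square mult_ac)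
      with s0 B show ?thesis
        by (cases "s = 0") auto
    qed
    moreover have "C\<^sup>2 * (norm f)\<^sup>2 \<le> (norm u)\<^sup>2"
    proof -
      have "C * (norm f)\<^sup>2 \<le> Re (cinner u f)"
        using C(2)[of f] infsumI[OF form[of f]] by simp
      also have "\<dots> \<le> norm u * norm f"
        using Cauchy_Schwarz_cinner complex_Re_le_cmod order_trans by blast
      finally have "C * norm f \<le> norm u"
        by (cases "f = 0") (auto simp: power2_eq_square)
      then have "(C * norm f)\<^sup>2 \<le> (norm u)\<^sup>2"
        using C(1) by (intro power_mono) auto
      then show ?thesis by (simp add: power_mult_distrib)
    qed
    moreover have "C\<^sup>2 * (s / B) \<le> C\<^sup>2 * (norm f)\<^sup>2"
      using \<open>s \<le> B * (norm f)\<^sup>2\<close> B by (intro mult_left_mono) (auto simp: field_simps)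
    ultimately have lower: "C\<^sup>2 / B * s \<le> (norm u)\<^sup>2" by simp
    have "(norm u)\<^sup>2 \<le> 4 * D\<^sup>2 * (norm f)\<^sup>2"
      using bi_g_frame_form_bound[OF ops sm real nonneg D] form[of u]
      by (simp only: cinner_self)
    also have "\<dots> \<le> 4 * D\<^sup>2 * (s / A)"
      using fs A by (intro mult_left_mono) (auto simp: field_simps)
    finally show ?thesis using lower by (simp add: s_def u_def)
  qed
  have "C\<^sup>2 / B > 0" "4 * D\<^sup>2 / A > 0" using A B C(1) D(1) by auto
  with bounds ops(2) bi_g_frame_g_complete[OF frame] show ?thesis
    unfolding g_Riesz_basis_def by blast
qed

theorem theorem3p3:
  fixes J :: "int set"
    and V :: "int \<Rightarrow> 'v::complex_hilbert_space set"
    and \<Lambda> \<Gamma> :: "int \<Rightarrow> 'u::complex_hilbert_space \<Rightarrow> 'v"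
  assumes "\<And>j. j \<in> J \<Longrightarrow> closed_csubspace (V j)"
    and "bi_g_frame J V \<Lambda> \<Gamma>"
  shows "g_Riesz_basis J V \<Lambda> \<longleftrightarrow> g_Riesz_basis J V \<Gamma>"
  \<comment> \<open>The converse is the same implication for the swapped pair.\<close>
  using bi_g_frame_g_Riesz_basis[OF assms]
    bi_g_frame_g_Riesz_basis[OF assms(1) bi_g_frame_sym[OF assms(2)]] by blast

end
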